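(* Let $X$ be a zero-dimensional metric space. Then the following assertions are equivalent: (i) $C_k(X,2)$ has countable tightness; (ii) $C_k(X,2)$ is a $\mathfrak{P}_0$-space; (iii) $C_p(X,2)$ has countable tightness; (iv) $X$ is separable.
   Context: Zero-dimensional means having a base of clopen sets. $2=\{0,1\}$ is the two-point discrete space. $C_k(X,2)$ (respectively $C_p(X,2)$) is the set of continuous functions $X\to 2$ with the compact-open topology (respectively the topology of pointwise convergence). A space $Z$ has countable tightness if whenever $z\in\overline{A}$ with $A\subseteq Z$, there is a countable $B\subseteq A$ with $z\in\overline{B}$. A family $\mathcal{N}$ of subsets of $Z$ is a network at $z\in Z$ if for every open $U\ni z$ there is $N\in\mathcal{N}$ with $z\in N\subseteq U$. $\mathcal{N}$ is a Pytkeev network at $z$ if it is a network at $z$ and for every open set $U\subseteq Z$ containing $z$ and every set $A\subseteq Z$ accumulating at $z$ (every neighborhood of $z$ contains infinitely many points of $A$) there is $N\in\mathcal{N}$ such that $N\subseteq U$ and $N\cap A$ is infinite. $\mathcal{N}$ is a Pytkeev network in $Z$ if it is a Pytkeev network at each point of $Z$. $Z$ is a $\mathfrak{P}_0$-space if it has a countable Pytkeev network. *)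

theory Defs
  imports "HOL-Analysis.Analysis"
begin

definition zero_dimensional :: "'a topology \<Rightarrow> bool" where
  "zero_dimensional X \<longleftrightarrow>
     (\<exists>\<B>. (\<forall>B\<in>\<B>. openin X B \<and> closedin X B) \<and>
          (\<forall>U x. openin X U \<and> x \<in> U \<longrightarrow> (\<exists>B\<in>\<B>. x \<in> B \<and> B \<subseteq> U)))"

definition two_point :: "nat topology" where
  "two_point = discrete_topology {0, 1}"

(* continuous_map ignores the values of a function outside the topspace; extensionality makes
   a continuous map from X to Y correspond to exactly one HOL function. *)
definition cont_maps :: "'a topology \<Rightarrow> 'b topology \<Rightarrow> ('a \<Rightarrow> 'b) set" where
  "cont_maps X Y = {f. continuous_map X Y f \<and> f \<in> extensional (topspace X)}"

definition compact_open_topology :: "'a topology \<Rightarrow> 'b topology \<Rightarrow> ('a \<Rightarrow> 'b) topology" where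
  "compact_open_topology X Y =
     topology_generated_by
       {{f \<in> cont_maps X Y. f ` K \<subseteq> U} | K U. compactin X K \<and> openin Y U}"

definition pointwise_topology :: "'a topology \<Rightarrow> 'b topology \<Rightarrow> ('a \<Rightarrow> 'b) topology" where
  "pointwise_topology X Y =
     subtopology (product_topology (\<lambda>_. Y) (topspace X)) (cont_maps X Y)"

lemma topspace_compact_open_topology [simp]:
  "topspace (compact_open_topology X Y) = cont_maps X Y"
proof -
  have "cont_maps X Y \<in> {{f \<in> cont_maps X Y. f ` K \<subseteq> U} | K U. compactin X K \<and> openin Y U}"
    by (rule CollectI, rule exI[of _ "{}"], rule exI[of _ "{}"]) auto
  then show ?thesis
    unfolding compact_open_topology_def topology_generated_by_topspace by blast
qed

lemma topspace_pointwise_topology [simp]: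
  "topspace (pointwise_topology X Y) = cont_maps X Y"
  by (auto simp: pointwise_topology_def cont_maps_def PiE_def continuous_map_def)

definition countable_tightness :: "'a topology \<Rightarrow> bool" where
  "countable_tightness Z \<longleftrightarrow>
     (\<forall>A z. A \<subseteq> topspace Z \<and> z \<in> Z closure_of A \<longrightarrow>
        (\<exists>B. B \<subseteq> A \<and> countable B \<and> z \<in> Z closure_of B))"

definition network_at :: "'a topology \<Rightarrow> 'a set set \<Rightarrow> 'a \<Rightarrow> bool" where
  "network_at Z \<N> z \<longleftrightarrow> (\<forall>U. openin Z U \<and> z \<in> U \<longrightarrow> (\<exists>N\<in>\<N>. z \<in> N \<and> N \<subseteq> U))"

definition accumulates_at :: "'a topology \<Rightarrow> 'a set \<Rightarrow> 'a \<Rightarrow> bool" where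
  "accumulates_at Z A z \<longleftrightarrow> (\<forall>U. openin Z U \<and> z \<in> U \<longrightarrow> infinite (U \<inter> A))"

definition Pytkeev_network_at :: "'a topology \<Rightarrow> 'a set set \<Rightarrow> 'a \<Rightarrow> bool" where
  "Pytkeev_network_at Z \<N> z \<longleftrightarrow>
     network_at Z \<N> z \<and>
     (\<forall>U A. openin Z U \<and> z \<in> U \<and> A \<subseteq> topspace Z \<and> accumulates_at Z A z \<longrightarrow>
        (\<exists>N\<in>\<N>. N \<subseteq> U \<and> infinite (N \<inter> A)))"

definition Pytkeev_network :: "'a topology \<Rightarrow> 'a set set \<Rightarrow> bool" where
  "Pytkeev_network Z \<N> \<longleftrightarrow>
     \<N> \<subseteq> Pow (topspace Z) \<and> (\<forall>z\<in>topspace Z. Pytkeev_network_at Z \<N> z)"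

definition P0_space :: "'a topology \<Rightarrow> bool" where
  "P0_space Z \<longleftrightarrow> (\<exists>\<N>. countable \<N> \<and> Pytkeev_network Z \<N>)"

end

theory Submission
  imports Defs
begin

text \<open>
  Fix a countable base closed under finite unions. The sets of maps that are 0 on \<open>B\<close> and 1 on \<open>B'\<close>,
  for \<open>B\<close> and \<open>B'\<close> in the base, form a countable Pytkeev network. Indeed, if \<open>K\<close> is compact and \<open>f\<close> is
  continuous, the base contains sets \<open>V 0 n\<close>, \<open>V 1 n\<close> shrinking to the parts of \<open>K\<close> where \<open>f\<close> is 0
  and 1; let \<open>N n\<close> be the set of maps that agree with \<open>f\<close> on \<open>V 0 n \<union> V 1 n\<close>. Every map agreeing with
  \<open>f\<close> on \<open>K\<close> is eventually in \<open>N n\<close>. If \<open>A\<close> met every \<open>N n\<close> in a finite set, pick for each \<open>g \<in> A\<close>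
  that agrees with \<open>f\<close> on \<open>K\<close> but is not in \<open>N 0\<close> a point of disagreement in the last \<open>V 0 n \<union> V 1 n\<close>
  that has one: these points together with \<open>K\<close> form a compact set on which only finitely many members
  of \<open>A\<close> agree with \<open>f\<close>, so \<open>A\<close> does not accumulate at \<open>f\<close>.

  Conversely, 0 is in the closure of the indicators of complements of clopen sets covered by finitely
  many \<open>e\<close>-balls; a countable subfamily with 0 in its closure yields a countable cover by \<open>e\<close>-balls.
\<close>

section \<open>Metric spaces\<close>

context Metric_space
begin

text \<open>The centres chosen for the radii \<open>inverse (Suc n)\<close> together form a dense
  set: by symmetry of \<open>d\<close>, a centre whose small ball contains \<open>x\<close> is
  itself close to \<open>x\<close>. Tightness yields a cover for one radius at a time, hence this
  form.\<close>

lemma separable_space_mtopology_if_countable_ball_covers: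
  assumes "\<And>e. e > 0 \<Longrightarrow> \<exists>C. countable C \<and> C \<subseteq> M \<and> M \<subseteq> (\<Union>c\<in>C. mball c e)"
  shows "separable_space mtopology"
proof -
  have "\<forall>n. \<exists>C. countable C \<and> C \<subseteq> M \<and> M \<subseteq> (\<Union>c\<in>C. mball c (inverse (real (Suc n))))"
    by (intro allI assms) simp
  then obtain C where C: "\<And>n. countable (C n)" "\<And>n. C n \<subseteq> M"
      "\<And>n. M \<subseteq> (\<Union>c\<in>C n. mball c (inverse (real (Suc n))))"
    by metis
  have "\<exists>y\<in>(\<Union>n. C n). y \<in> mball x r" if x: "x \<in> M" and r: "r > 0" for x r
  proof -
    obtain n where n: "inverse (real (Suc n)) < r"
      using reals_Archimedean[OF r] by blast
    obtain c where c: "c \<in> C n" "x \<in> mball c (inverse (real (Suc n)))"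
      using C(3) x by blast
    then have "c \<in> mball x r"
      using n by (auto simp: commute)
    then show ?thesis
      using c by blast
  qed
  then have "mtopology closure_of (\<Union>n. C n) = topspace mtopology"
    by (auto simp: metric_closure_of)
  moreover have "countable (\<Union>n. C n)" "(\<Union>n. C n) \<subseteq> topspace mtopology"
    using C by auto
  ultimately show ?thesis
    unfolding separable_space_def by blast
qed

lemma separable_imp_second_countable_mtopology:
  assumes "separable_space mtopology"
  shows "second_countable mtopology"
proof -
  obtain C where C: "countable C" "C \<subseteq> M" "mtopology closure_of C = M"
    using assms by (auto simp: separable_space_def)
  define \<B> where "\<B> = (\<lambda>(c, n). mball c (inverse (real (Suc n)))) ` (C \<times> UNIV)"
  have "countable \<B>"
    unfolding \<B>_def using C by auto
  moreover have "\<forall>V\<in>\<B>. openin mtopology V"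
    by (auto simp: \<B>_def)
  moreover have "\<exists>V\<in>\<B>. x \<in> V \<and> V \<subseteq> U" if U: "openin mtopology U" "x \<in> U" for U x
  proof -
    obtain r where r: "r > 0" "mball x r \<subseteq> U"
      using U by (meson openin_mtopology)
    have x: "x \<in> M"
      using U openin_subset by fastforce
    \<comment> \<open>Half of \<open>r\<close>, because two distances below this radius are added in
      the triangle inequality: from \<open>x\<close> to \<open>c\<close> and from \<open>c\<close>
      to \<open>y\<close>.\<close>
    obtain n where n: "inverse (real (Suc n)) < r / 2"
      using r reals_Archimedean[of "r / 2"] by auto
    have "x \<in> mtopology closure_of C"
      using C x by simp
    moreover have "inverse (real (Suc n)) > 0"
      by simp
    ultimately obtain c where c: "c \<in> C" "c \<in> mball x (inverse (real (Suc n)))"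
      unfolding metric_closure_of by blast
    have "y \<in> mball x r" if "y \<in> mball c (inverse (real (Suc n)))" for y
    proof -
      have "d x y \<le> d x c + d c y"
        using that c by (intro triangle) auto
      then show ?thesis
        using that c n by auto
    qed
    moreover have "x \<in> mball c (inverse (real (Suc n)))"
      using c by (auto simp: commute)
    moreover have "mball c (inverse (real (Suc n))) \<in> \<B>"
      using c unfolding \<B>_def by blast
    ultimately show ?thesis
      using r by blast
  qed
  ultimately show ?thesis
    unfolding second_countable_def by blast
qed

end

section \<open>Function spaces\<close>

text \<open>Membership in a subbasic set depends only on the values on its compact set, and finite
  intersections only unite compact sets. No property of \<open>Y\<close> enters here; the agreement
  sets are shown to be open only for the two-point space, further below.\<close>

lemma openin_compact_open_topology_agree:
  assumes "openin (compact_open_topology X Y) U" "f \<in> U"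
  obtains K where "compactin X K" "{g \<in> cont_maps X Y. \<forall>x\<in>K. g x = f x} \<subseteq> U"
proof -
  have "generate_topology_on {{f \<in> cont_maps X Y. f ` K \<subseteq> U} | K U. compactin X K \<and> openin Y U} U"
    using assms(1) unfolding compact_open_topology_def by (rule openin_topology_generated_by)
  \<comment> \<open>The premise \<open>f \<in> U\<close> belongs to the induction formula, since the
    sets from which \<open>U\<close> is generated need not all contain \<open>f\<close>.\<close>
  then have "f \<in> U \<longrightarrow> (\<exists>K. compactin X K \<and> {g \<in> cont_maps X Y. \<forall>x\<in>K. g x = f x} \<subseteq> U)"
  proof (induction rule: generate_topology_on.induct)
    case (Int a b)
    show ?case
    proof
      assume "f \<in> a \<inter> b"
      then obtain K L where "compactin X K" "{g \<in> cont_maps X Y. \<forall>x\<in>K. g x = f x} \<subseteq> a"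
          "compactin X L" "{g \<in> cont_maps X Y. \<forall>x\<in>L. g x = f x} \<subseteq> b"
        using Int by auto
      then show "\<exists>K. compactin X K \<and> {g \<in> cont_maps X Y. \<forall>x\<in>K. g x = f x} \<subseteq> a \<inter> b"
        by (intro exI[of _ "K \<union> L"]) (auto simp: compactin_Un)
    qed
  next
    case (UN \<K>)
    then show ?case
      by (meson UnionE Union_upper subset_trans)
  next
    case (Basis s)
    then obtain K V where "compactin X K" "s = {f \<in> cont_maps X Y. f ` K \<subseteq> V}"
      by auto
    then show ?case
      by (intro impI exI[of _ K]) auto
  qed auto
  then show thesis
    using that assms(2) by blast
qed

section \<open>Clopen fibres of maps into the two-point space\<close>

lemma cont_maps_two_point_values:
  assumes "f \<in> cont_maps X two_point" "x \<in> topspace X"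
  shows "f x = 0 \<or> f x = 1"
  using assms by (auto simp: cont_maps_def two_point_def continuous_map_def Pi_iff)

lemma openin_cont_maps_two_point_vimage:
  assumes "f \<in> cont_maps X two_point"
  shows "openin X {x \<in> topspace X. f x = i}"
proof -
  \<comment> \<open>The intersection is an open subset of the two-point space for every natural
    \<open>i\<close>, so no case distinction is needed: other values have empty fibres.\<close>
  have "openin X {x \<in> topspace X. f x \<in> {i} \<inter> {0, 1}}"
    using assms unfolding cont_maps_def two_point_def
    by (intro openin_continuous_map_preimage[of X "discrete_topology {0, 1}"]) auto
  moreover have "{x \<in> topspace X. f x \<in> {i} \<inter> {0, 1}} = {x \<in> topspace X. f x = i}"
    using cont_maps_two_point_values[OF assms] by auto
  ultimately show ?thesis
    by simp
qed

lemma compactin_Int_cont_maps_two_point_vimage: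
  assumes "f \<in> cont_maps X two_point" "compactin X K"
  shows "compactin X {x \<in> K. f x = i}"
proof -
  have "closedin X {x \<in> topspace X. f x \<in> {i} \<inter> {0, 1}}"
    using assms unfolding cont_maps_def two_point_def
    by (intro closedin_continuous_map_preimage[of X "discrete_topology {0, 1}"]) auto
  then have "compactin X ({x \<in> topspace X. f x \<in> {i} \<inter> {0, 1}} \<inter> K)"
    using assms(2) by (rule closed_Int_compactin)
  moreover have "{x \<in> topspace X. f x \<in> {i} \<inter> {0, 1}} \<inter> K = {x \<in> K. f x = i}"
    using cont_maps_two_point_values[OF assms(1)] compactin_subset_topspace[OF assms(2)] by auto
  ultimately show ?thesis
    by simp
qed

text \<open>As the target is discrete, agreeing with \<open>f\<close> on \<open>K\<close> amounts to
  two subbasic conditions, one on each of the compact pieces of \<open>K\<close> where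
  \<open>f\<close> is 0 and where \<open>f\<close> is 1.\<close>

lemma openin_compact_open_topology_two_point_agree:
  assumes f: "f \<in> cont_maps X two_point" and K: "compactin X K"
  shows "openin (compact_open_topology X two_point)
           {g \<in> cont_maps X two_point. \<forall>x\<in>K. g x = f x}"
proof -
  define S where "S i = {g \<in> cont_maps X two_point. g ` {x \<in> K. f x = i} \<subseteq> {i} \<inter> {0, 1}}" for i
  have "openin (compact_open_topology X two_point) (S i)" for i
    unfolding compact_open_topology_def
  proof (rule topology_generated_by_Basis, intro CollectI exI conjI)
    show "S i = {g \<in> cont_maps X two_point. g ` {x \<in> K. f x = i} \<subseteq> {i} \<inter> {0, 1}}"
      by (rule S_def)
    show "compactin X {x \<in> K. f x = i}"
      using f K by (rule compactin_Int_cont_maps_two_point_vimage)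
    show "openin two_point ({i} \<inter> {0, 1})"
      by (auto simp: two_point_def)
  qed
  then have "openin (compact_open_topology X two_point) (S 0 \<inter> S 1)"
    by blast
  moreover have "S 0 \<inter> S 1 = {g \<in> cont_maps X two_point. \<forall>x\<in>K. g x = f x}"
  proof -
    have "f x = 0 \<or> f x = 1" if "x \<in> K" for x
      using cont_maps_two_point_values[OF f] compactin_subset_topspace[OF K] that by blast
    then show ?thesis
      by (fastforce simp: S_def image_subset_iff)
  qed
  ultimately show ?thesis
    by simp
qed

section \<open>The pointwise topology and its comparison with the compact-open one\<close>

lemma openin_pointwise_topology_agree:
  assumes "openin (pointwise_topology X Y) U" "f \<in> U"
  obtains F where "finite F" "F \<subseteq> topspace X" "{g \<in> cont_maps X Y. \<forall>x\<in>F. g x = f x} \<subseteq> U"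
proof -
  obtain T where T: "openin (product_topology (\<lambda>_. Y) (topspace X)) T" "U = T \<inter> cont_maps X Y"
    using assms(1) by (auto simp: pointwise_topology_def openin_subtopology)
  obtain W where W: "finite {i \<in> topspace X. W i \<noteq> topspace Y}" "f \<in> Pi\<^sub>E (topspace X) W"
      "Pi\<^sub>E (topspace X) W \<subseteq> T"
    using T assms(2) by (force simp: openin_product_topology_alt)
  \<comment> \<open>Only finitely many coordinates of the basic box are restricted, and there
    \<open>g\<close> takes the values of \<open>f\<close>, which lies in the box. Extensionality
    settles the points outside \<open>topspace X\<close>.\<close>
  have "g \<in> Pi\<^sub>E (topspace X) W"
    if "g \<in> cont_maps X Y" "\<forall>x\<in>{i \<in> topspace X. W i \<noteq> topspace Y}. g x = f x" for g
  proof (rule PiE_I)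
    fix x assume x: "x \<in> topspace X"
    show "g x \<in> W x"
    proof (cases "W x = topspace Y")
      case True
      then show ?thesis
        using that x by (auto simp: cont_maps_def continuous_map_def)
    next
      case False
      then show ?thesis
        using that x W(2) by (auto dest: PiE_mem)
    qed
  next
    fix x assume "x \<notin> topspace X"
    then show "g x = undefined"
      using that by (auto simp: cont_maps_def extensional_def)
  qed
  then have "{g \<in> cont_maps X Y. \<forall>x\<in>{i \<in> topspace X. W i \<noteq> topspace Y}. g x = f x} \<subseteq> U"
    using W(3) T(2) by blast
  then show thesis
    using W(1) by (intro that[of "{i \<in> topspace X. W i \<noteq> topspace Y}"]) auto
qed

lemma openin_pointwise_topology_eval:
  assumes "x \<in> topspace X" "openin Y V"
  shows "openin (pointwise_topology X Y) {g \<in> cont_maps X Y. g x \<in> V}"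
proof -
  have "openin (product_topology (\<lambda>_. Y) (topspace X))
          {g \<in> topspace (product_topology (\<lambda>_. Y) (topspace X)). g x \<in> V}"
    using assms by (intro openin_continuous_map_preimage[of _ Y] continuous_map_product_projection)
  moreover have "{g \<in> cont_maps X Y. g x \<in> V} =
      {g \<in> topspace (product_topology (\<lambda>_. Y) (topspace X)). g x \<in> V} \<inter> cont_maps X Y"
    by (auto simp: cont_maps_def PiE_def continuous_map_def)
  ultimately show ?thesis
    unfolding pointwise_topology_def openin_subtopology by blast
qed

text \<open>Finite subsets of \<open>topspace X\<close> are compact, so agreement with
  \<open>f\<close> on such a set is already a compact-open neighborhood of \<open>f\<close>.\<close>

lemma openin_compact_open_topology_if_pointwise:
  assumes "openin (pointwise_topology X two_point) U"
  shows "openin (compact_open_topology X two_point) U"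
proof (subst openin_subopen, intro ballI)
  fix f assume f: "f \<in> U"
  then have fC: "f \<in> cont_maps X two_point"
    using openin_subset[OF assms] by auto
  obtain F where F: "finite F" "F \<subseteq> topspace X"
      "{g \<in> cont_maps X two_point. \<forall>x\<in>F. g x = f x} \<subseteq> U"
    using openin_pointwise_topology_agree[OF assms f] .
  then show "\<exists>T. openin (compact_open_topology X two_point) T \<and> f \<in> T \<and> T \<subseteq> U"
    using fC openin_compact_open_topology_two_point_agree[OF fC finite_imp_compactin, of F]
    by (intro exI[of _ "{g \<in> cont_maps X two_point. \<forall>x\<in>F. g x = f x}"]) auto
qed

section \<open>Countable tightness\<close>

text \<open>One point of \<open>A\<close> is chosen from each network member that meets
  \<open>A\<close>. The network is used at a point \<open>a \<in> A\<close> of the given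
  neighborhood of \<open>z\<close>, not at \<open>z\<close>, so it has to be a network at all
  points.\<close>

lemma countable_tightness_if_countable_network:
  assumes "countable \<N>" and net: "\<And>z. z \<in> topspace Z \<Longrightarrow> network_at Z \<N> z"
  shows "countable_tightness Z"
  unfolding countable_tightness_def
proof (intro allI impI, elim conjE)
  fix A z assume A: "A \<subseteq> topspace Z" and z: "z \<in> Z closure_of A"
  have "\<forall>N. \<exists>a. N \<inter> A \<noteq> {} \<longrightarrow> a \<in> N \<inter> A"
    by blast
  then obtain p where p: "\<And>N. N \<inter> A \<noteq> {} \<Longrightarrow> p N \<in> N \<inter> A"
    by metis
  define B where "B = p ` {N \<in> \<N>. N \<inter> A \<noteq> {}}"
  have "\<exists>y. y \<in> B \<and> y \<in> T" if T: "z \<in> T" "openin Z T" for T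
  proof -
    obtain a where a: "a \<in> A" "a \<in> T"
      using z T by (auto simp: in_closure_of)
    then obtain N where N: "N \<in> \<N>" "a \<in> N" "N \<subseteq> T"
      using net[of a] A T unfolding network_at_def by blast
    then show ?thesis
      using p[of N] a by (auto simp: B_def)
  qed
  then have "z \<in> Z closure_of B"
    using z by (simp add: in_closure_of)
  moreover have "B \<subseteq> A"
    using p by (auto simp: B_def)
  moreover have "countable B"
    using assms(1) by (auto simp: B_def)
  ultimately show "\<exists>B. B \<subseteq> A \<and> countable B \<and> z \<in> Z closure_of B"
    by blast
qed

text \<open>A network remains one when open sets are removed. Hence a single Pytkeev network serves
  both the compact-open and the pointwise topology.\<close>

lemma P0_space_imp_countable_tightness_coarser:
  assumes "P0_space Z" "topspace Z' = topspace Z" "\<And>U. openin Z' U \<Longrightarrow> openin Z U"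
  shows "countable_tightness Z'"
proof -
  obtain \<N> where "countable \<N>" "Pytkeev_network Z \<N>"
    using assms(1) by (auto simp: P0_space_def)
  then show ?thesis
    using assms(2,3)
    by (intro countable_tightness_if_countable_network[of \<N>])
      (auto simp: Pytkeev_network_def Pytkeev_network_at_def network_at_def)
qed

section \<open>From countable tightness to separability\<close>

lemma zero_dimensional_compactin_clopen_nbhd:
  assumes "zero_dimensional X" "compactin X K"
    and "\<And>x. x \<in> K \<Longrightarrow> openin X (T x) \<and> x \<in> T x"
  obtains W F where "openin X W" "closedin X W" "finite F" "F \<subseteq> K" "K \<subseteq> W" "W \<subseteq> (\<Union>x\<in>F. T x)"
proof -
  obtain \<B> where \<B>: "\<And>B. B \<in> \<B> \<Longrightarrow> openin X B \<and> closedin X B"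
      "\<And>U x. openin X U \<Longrightarrow> x \<in> U \<Longrightarrow> \<exists>B\<in>\<B>. x \<in> B \<and> B \<subseteq> U"
    using assms(1) unfolding zero_dimensional_def by metis
  have "\<forall>x\<in>K. \<exists>B\<in>\<B>. x \<in> B \<and> B \<subseteq> T x"
    using \<B>(2) assms(3) by blast
  then obtain b where b: "\<And>x. x \<in> K \<Longrightarrow> b x \<in> \<B> \<and> x \<in> b x \<and> b x \<subseteq> T x"
    by metis
  obtain \<F> where \<F>: "finite \<F>" "\<F> \<subseteq> b ` K" "K \<subseteq> \<Union>\<F>"
    using compactinD[OF assms(2), of "b ` K"] b \<B>(1) by blast
  then obtain F where F: "finite F" "F \<subseteq> K" "\<F> = b ` F"
    by (meson finite_subset_image)
  have bF: "\<And>x. x \<in> F \<Longrightarrow> openin X (b x) \<and> closedin X (b x)"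
    using F b \<B>(1) by blast
  show thesis
  proof
    show "openin X (\<Union>x\<in>F. b x)" "closedin X (\<Union>x\<in>F. b x)"
      using bF F(1) by (auto intro!: closedin_Union)
    show "finite F" "F \<subseteq> K" "K \<subseteq> (\<Union>x\<in>F. b x)"
      using F \<F> by auto
    show "(\<Union>x\<in>F. b x) \<subseteq> (\<Union>x\<in>F. T x)"
      using b F by blast
  qed
qed

lemma indicator_in_cont_maps_two_point:
  assumes "openin X W" "closedin X W"
  shows "(\<lambda>x\<in>topspace X. if x \<in> W then 0 else 1) \<in> cont_maps X two_point"
proof -
  have "openin X {x \<in> topspace X. (\<lambda>x\<in>topspace X. if x \<in> W then 0 else (1::nat)) x \<in> V}" for V
  proof -
    have "{x \<in> topspace X. (\<lambda>x\<in>topspace X. if x \<in> W then 0 else (1::nat)) x \<in> V}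
        = (if 0 \<in> V then W else {}) \<union> (if 1 \<in> V then topspace X - W else {})"
      using openin_subset[OF assms(1)] by (auto split: if_splits)
    then show ?thesis
      using assms by (auto simp: closedin_def)
  qed
  then show ?thesis
    by (auto simp: cont_maps_def two_point_def continuous_map_def)
qed

text \<open>An abstract \<open>Z\<close> lets one argument cover both topologies:
  \<open>agree\<close> says that \<open>Z\<close> has no finer neighborhoods than the compact-open
  topology, \<open>eval\<close> that vanishing at a point is an open condition.\<close>

lemma (in Metric_space) countable_tightness_imp_separable:
  assumes zd: "zero_dimensional mtopology"
    and ct: "countable_tightness Z" and Z: "topspace Z = cont_maps mtopology two_point"
    and agree: "\<And>U f. openin Z U \<Longrightarrow> f \<in> U \<Longrightarrow>
      \<exists>K. compactin mtopology K \<and> {g \<in> cont_maps mtopology two_point. \<forall>x\<in>K. g x = f x} \<subseteq> U"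
    and eval: "\<And>x. x \<in> M \<Longrightarrow> openin Z {g \<in> cont_maps mtopology two_point. g x = 0}"
  shows "separable_space mtopology"
proof (rule separable_space_mtopology_if_countable_ball_covers)
  fix e :: real assume e: "e > 0"
  \<comment> \<open>The value is 0 on \<open>W\<close> and 1 off it, so \<open>h M\<close> is the
    zero map and \<open>h W\<close> agrees with it exactly on \<open>W\<close>.\<close>
  define h :: "'a set \<Rightarrow> 'a \<Rightarrow> nat" where "h W = (\<lambda>x\<in>M. if x \<in> W then 0 else 1)" for W
  define \<W> where "\<W> = {W. openin mtopology W \<and> closedin mtopology W \<and>
      (\<exists>F. finite F \<and> F \<subseteq> M \<and> W \<subseteq> (\<Union>c\<in>F. mball c e))}"
  have h: "h W \<in> cont_maps mtopology two_point" if "openin mtopology W" "closedin mtopology W" for W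
    unfolding h_def using indicator_in_cont_maps_two_point[OF that] by simp
  have hM: "h M \<in> cont_maps mtopology two_point"
    using h[of M] by (metis closedin_topspace openin_topspace topspace_mtopology)
  have "h M \<in> Z closure_of (h ` \<W>)"
    unfolding in_closure_of
  proof (intro conjI allI impI; (elim conjE)?)
    show "h M \<in> topspace Z"
      using hM Z by simp
    fix U assume U: "h M \<in> U" "openin Z U"
    obtain K where K: "compactin mtopology K"
        "{g \<in> cont_maps mtopology two_point. \<forall>x\<in>K. g x = h M x} \<subseteq> U"
      using agree[OF U(2,1)] by blast
    have KM: "K \<subseteq> M"
      using compactin_subset_topspace[OF K(1)] by simp
    have "\<And>x. x \<in> K \<Longrightarrow> openin mtopology (mball x e) \<and> x \<in> mball x e"
      using KM e by auto
    then obtain W F where W: "openin mtopology W" "closedin mtopology W" "finite F" "F \<subseteq> K" "K \<subseteq> W"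
        "W \<subseteq> (\<Union>c\<in>F. mball c e)"
      using zero_dimensional_compactin_clopen_nbhd[OF zd K(1), of "\<lambda>x. mball x e"] by metis
    have "W \<in> \<W>"
      unfolding \<W>_def using W KM by blast
    moreover have "\<forall>x\<in>K. h W x = h M x"
      using W(5) KM by (auto simp: h_def)
    then have "h W \<in> U"
      using K(2) h[OF W(1,2)] by blast
    ultimately show "\<exists>y. y \<in> h ` \<W> \<and> y \<in> U"
      by blast
  qed
  moreover have "h ` \<W> \<subseteq> topspace Z"
    using h Z by (auto simp: \<W>_def)
  ultimately obtain B where B: "B \<subseteq> h ` \<W>" "countable B" "h M \<in> Z closure_of B"
    using ct unfolding countable_tightness_def by meson
  \<comment> \<open>One clopen set is kept per function in \<open>B\<close>, so that countability
    passes from functions to sets.\<close>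
  then obtain \<V> where \<V>: "\<V> \<subseteq> \<W>" "countable \<V>" "B = h ` \<V>"
    by (meson countable_subset_image)
  have "\<forall>W\<in>\<V>. \<exists>F. finite F \<and> F \<subseteq> M \<and> W \<subseteq> (\<Union>c\<in>F. mball c e)"
    using \<V>(1) by (auto simp: \<W>_def)
  then obtain F where F: "\<And>W. W \<in> \<V> \<Longrightarrow> finite (F W) \<and> F W \<subseteq> M \<and> W \<subseteq> (\<Union>c\<in>F W. mball c e)"
    by metis
  \<comment> \<open>Since the zero map is in the closure of \<open>B\<close>, some member of
    \<open>B\<close> vanishes at \<open>x\<close>; this places \<open>x\<close> in a set of
    \<open>\<V>\<close>.\<close>
  have "x \<in> (\<Union>c\<in>(\<Union>W\<in>\<V>. F W). mball c e)" if x: "x \<in> M" for x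
  proof -
    have "h M \<in> {g \<in> cont_maps mtopology two_point. g x = 0}"
      using hM x by (simp add: h_def)
    then obtain g where "g \<in> B" "g \<in> {g \<in> cont_maps mtopology two_point. g x = 0}"
      using B(3) eval[OF x] unfolding in_closure_of by meson
    then obtain W where "W \<in> \<V>" "h W x = 0"
      using \<V>(3) by auto
    then show ?thesis
      using F[of W] x by (force simp: h_def split: if_splits)
  qed
  then have "M \<subseteq> (\<Union>c\<in>(\<Union>W\<in>\<V>. F W). mball c e)"
    by blast
  moreover have "countable (\<Union>W\<in>\<V>. F W)"
    using F \<V>(2) by (intro countable_UN) (auto intro: countable_finite)
  moreover have "(\<Union>W\<in>\<V>. F W) \<subseteq> M"
    using F by blast
  ultimately show "\<exists>C. countable C \<and> C \<subseteq> M \<and> M \<subseteq> (\<Union>c\<in>C. mball c e)"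
    by blast
qed

section \<open>Pytkeev networks\<close>

text \<open>By compactness and closure under finite unions, every open set around \<open>K\<close>
  contains a base member around \<open>K\<close>. There are only countably many of these, so
  \<open>V n\<close> can be put inside the first \<open>n + 1\<close> of them. The
  \<open>V n\<close> need not be nested.\<close>

lemma compactin_shrinking_base_sequence:
  assumes "countable \<B>" and open_\<B>: "\<And>B. B \<in> \<B> \<Longrightarrow> openin X B"
    and base: "\<And>U x. openin X U \<Longrightarrow> x \<in> U \<Longrightarrow> \<exists>B\<in>\<B>. x \<in> B \<and> B \<subseteq> U"
    and Union: "\<And>\<F>. finite \<F> \<Longrightarrow> \<F> \<subseteq> \<B> \<Longrightarrow> \<Union>\<F> \<in> \<B>"
    and K: "compactin X K" and W: "openin X W" "K \<subseteq> W"
  obtains V :: "nat \<Rightarrow> 'a set" where "\<And>n. V n \<in> \<B>" "\<And>n. K \<subseteq> V n" "\<And>n. V n \<subseteq> W"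
    "\<And>U. openin X U \<Longrightarrow> K \<subseteq> U \<Longrightarrow> \<forall>\<^sub>F n in sequentially. V n \<subseteq> U"
proof -
  have interpolate: "\<exists>B\<in>\<B>. K \<subseteq> B \<and> B \<subseteq> U" if U: "openin X U" "K \<subseteq> U" for U
  proof -
    have "K \<subseteq> \<Union>{B \<in> \<B>. B \<subseteq> U}"
      using base[OF U(1)] U(2) by blast
    then obtain \<F> where "finite \<F>" "\<F> \<subseteq> {B \<in> \<B>. B \<subseteq> U}" "K \<subseteq> \<Union>\<F>"
      using compactinD[OF K, of "{B \<in> \<B>. B \<subseteq> U}"] open_\<B> by blast
    then show ?thesis
      using Union[of \<F>] by blast
  qed
  define \<K> where "\<K> = {B \<in> \<B>. K \<subseteq> B}"
  \<comment> \<open>Nonemptiness makes \<open>from_nat_into\<close> stay in \<open>\<K>\<close>; the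
    enumeration repeats members if \<open>\<K>\<close> is finite.\<close>
  have \<K>: "countable \<K>" "\<K> \<noteq> {}"
    using assms(1) interpolate[OF W] by (auto simp: \<K>_def)
  have mem: "from_nat_into \<K> n \<in> \<K>" for n
    using \<K>(2) by (rule from_nat_into)
  have "\<exists>B\<in>\<B>. K \<subseteq> B \<and> B \<subseteq> W \<inter> (\<Inter>i\<le>n. from_nat_into \<K> i)" for n
    using mem W open_\<B> by (intro interpolate openin_Int openin_INT2) (auto simp: \<K>_def)
  then obtain V where V: "\<And>n. V n \<in> \<B> \<and> K \<subseteq> V n \<and> V n \<subseteq> W \<inter> (\<Inter>i\<le>n. from_nat_into \<K> i)"
    by metis
  show thesis
  proof
    fix U assume U: "openin X U" "K \<subseteq> U"
    then obtain B where B: "B \<in> \<K>" "B \<subseteq> U"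
      unfolding \<K>_def using interpolate by blast
    then obtain i where "B = from_nat_into \<K> i"
      using from_nat_into_surj[OF \<K>(1)] by metis
    then have "V n \<subseteq> U" if "n \<ge> i" for n
      using V[of n] B that by blast
    then show "\<forall>\<^sub>F n in sequentially. V n \<subseteq> U"
      by (auto simp: eventually_sequentially)
  qed (use V in auto)
qed

text \<open>This generalises a convergent sequence together with its limit: a finite cover of
  \<open>K\<close> leaves out only finitely many of the added points.\<close>

lemma compactin_Un_converging_points:
  assumes K: "compactin X K" and x: "\<And>a. a \<in> A \<Longrightarrow> x a \<in> topspace X"
    and conv: "\<And>U. openin X U \<Longrightarrow> K \<subseteq> U \<Longrightarrow> finite {a \<in> A. x a \<notin> U}"
  shows "compactin X (K \<union> x ` A)"
  unfolding compactin_def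
proof (intro conjI allI impI; (elim conjE)?)
  show "K \<union> x ` A \<subseteq> topspace X"
    using x compactin_subset_topspace[OF K] by auto
  fix \<U> assume \<U>: "\<forall>U\<in>\<U>. openin X U" "K \<union> x ` A \<subseteq> \<Union>\<U>"
  obtain \<F> where \<F>: "finite \<F>" "\<F> \<subseteq> \<U>" "K \<subseteq> \<Union>\<F>"
    using compactinD[OF K, of \<U>] \<U> by auto
  define L where "L = x ` {a \<in> A. x a \<notin> \<Union>\<F>}"
  have "finite {a \<in> A. x a \<notin> \<Union>\<F>}"
    using \<F> \<U> by (intro conv openin_Union) auto
  then have "compactin X L"
    unfolding L_def using x by (intro finite_imp_compactin) auto
  moreover have "L \<subseteq> \<Union>\<U>"
    using \<U>(2) by (auto simp: L_def)
  ultimately obtain \<G> where \<G>: "finite \<G>" "\<G> \<subseteq> \<U>" "L \<subseteq> \<Union>\<G>"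
    using \<U>(1) compactinD[of X L \<U>] by auto
  have "K \<union> x ` A \<subseteq> \<Union>(\<F> \<union> \<G>)"
  proof -
    have "x ` A \<subseteq> \<Union>\<F> \<union> L"
      by (auto simp: L_def)
    then show ?thesis
      using \<F>(3) \<G>(3) by blast
  qed
  then show "\<exists>\<F>. finite \<F> \<and> \<F> \<subseteq> \<U> \<and> K \<union> x ` A \<subseteq> \<Union>\<F>"
    using \<F> \<G> by (intro exI[of _ "\<F> \<union> \<G>"]) auto
qed

lemma not_accumulates_at_compact_open_topology:
  assumes f: "f \<in> cont_maps X two_point" and K: "compactin X K"
    and A: "\<And>g. g \<in> A \<Longrightarrow> g \<in> cont_maps X two_point"
    and V: "\<And>n. V n \<subseteq> topspace X"
    and shrink: "\<And>U. openin X U \<Longrightarrow> K \<subseteq> U \<Longrightarrow> \<forall>\<^sub>F n in sequentially. V n \<subseteq> U"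
    and fin: "\<And>n. finite {g \<in> A. \<forall>x\<in>V n. g x = f x}"
  shows "\<not> accumulates_at (compact_open_topology X two_point) A f"
proof
  assume acc: "accumulates_at (compact_open_topology X two_point) A f"
  \<comment> \<open>Members of \<open>A\<close> outside \<open>A'\<close> are harmless: they either
    differ from \<open>f\<close> on \<open>K\<close> or agree with it on \<open>V 0\<close>, and
    \<open>fin\<close> bounds the latter.\<close>
  define A' where "A' = {g \<in> A. (\<forall>x\<in>K. g x = f x) \<and> (\<exists>x\<in>V 0. g x \<noteq> f x)}"
  define bad where "bad g n \<longleftrightarrow> (\<exists>x\<in>V n. g x \<noteq> f x)" for g n
  define m where "m g = Max {n. bad g n}" for g
  \<comment> \<open>The maximum exists: the set \<open>U\<close> where \<open>g\<close> and
    \<open>f\<close> agree is open and contains \<open>K\<close>, so it contains almost all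
    \<open>V n\<close>, while 0 is a bad index by the choice of \<open>A'\<close>.\<close>
  have m: "bad g (m g) \<and> (\<forall>n. bad g n \<longrightarrow> n \<le> m g)" if g: "g \<in> A'" for g
  proof -
    define U where "U = (\<Union>i. {x \<in> topspace X. g x = i} \<inter> {x \<in> topspace X. f x = i})"
    have "openin X U"
      unfolding U_def using f A g
      by (intro openin_Union openin_Int ballI)
        (auto simp: A'_def intro!: openin_Int openin_cont_maps_two_point_vimage)
    moreover have "K \<subseteq> U"
      using g compactin_subset_topspace[OF K] by (auto simp: U_def A'_def)
    ultimately obtain N where "\<And>n. n \<ge> N \<Longrightarrow> V n \<subseteq> U"
      using shrink unfolding eventually_sequentially by blast
    moreover have "\<not> bad g n" if "V n \<subseteq> U" for n
      using that by (auto simp: bad_def U_def)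
    ultimately have "{n. bad g n} \<subseteq> {..<N}"
      by (metis lessThan_iff mem_Collect_eq not_le_imp_less subsetI)
    then have "finite {n. bad g n}"
      using finite_subset by blast
    moreover have "{n. bad g n} \<noteq> {}"
      using g by (auto simp: bad_def A'_def)
    ultimately show ?thesis
      unfolding m_def using Max_in Max_ge by blast
  qed
  then have "\<forall>g\<in>A'. \<exists>x\<in>V (m g). g x \<noteq> f x"
    by (auto simp: bad_def)
  then obtain p where p: "\<And>g. g \<in> A' \<Longrightarrow> p g \<in> V (m g) \<and> g (p g) \<noteq> f (p g)"
    by metis
  have "compactin X (K \<union> p ` A')"
  proof (rule compactin_Un_converging_points[OF K])
    fix U assume U: "openin X U" "K \<subseteq> U"
    then obtain N where N: "\<And>n. n \<ge> N \<Longrightarrow> V n \<subseteq> U"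
      using shrink unfolding eventually_sequentially by blast
    \<comment> \<open>If \<open>p g\<close> escapes \<open>U\<close>, then \<open>m g < N\<close>.
      As \<open>m g\<close> is the last bad index, \<open>g\<close> agrees with \<open>f\<close> on
      \<open>V N\<close>, which \<open>fin\<close> allows for finitely many \<open>g\<close>
      only.\<close>
    have "{g \<in> A'. p g \<notin> U} \<subseteq> {g \<in> A. \<forall>x\<in>V N. g x = f x}"
    proof safe
      fix g x assume g: "g \<in> A'" "p g \<notin> U" and x: "x \<in> V N"
      then have "m g < N"
        using N[of "m g"] p[of g] by (meson not_le_imp_less subsetD)
      then have "\<not> bad g N"
        using m[OF g(1)] by (meson not_le)
      then show "g x = f x"
        using x by (auto simp: bad_def)
    qed (auto simp: A'_def)
    then show "finite {g \<in> A'. p g \<notin> U}"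
      using fin finite_subset by blast
  qed (use p V in blast)
  then have "infinite ({g \<in> cont_maps X two_point. \<forall>x\<in>K \<union> p ` A'. g x = f x} \<inter> A)"
    using acc f openin_compact_open_topology_two_point_agree[OF f]
    unfolding accumulates_at_def by blast
  moreover have "{g \<in> cont_maps X two_point. \<forall>x\<in>K \<union> p ` A'. g x = f x} \<inter> A
      \<subseteq> {g \<in> A. \<forall>x\<in>V 0. g x = f x}"
  proof (intro subsetI CollectI conjI ballI; elim IntE CollectE conjE)
    fix g x
    assume g: "g \<in> A" "\<forall>x\<in>K \<union> p ` A'. g x = f x" and x: "x \<in> V 0"
    have "g \<notin> A'"
      using p[of g] g(2) by blast
    then show "g x = f x"
      using g x by (auto simp: A'_def)
  qed
  ultimately show False
    using fin finite_subset by blast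
qed

theorem P0_space_compact_open_topology_two_point:
  assumes "second_countable X"
  shows "P0_space (compact_open_topology X two_point)"
proof -
  let ?Z = "compact_open_topology X two_point" and ?C = "cont_maps X two_point"
  obtain \<C> where \<C>: "countable \<C>" "\<forall>B\<in>\<C>. openin X B"
      "\<forall>U x. openin X U \<and> x \<in> U \<longrightarrow> (\<exists>B\<in>\<C>. x \<in> B \<and> B \<subseteq> U)"
    using assms unfolding second_countable_def by (elim exE conjE) (rule that)
  define \<B> where "\<B> = Union ` {\<F>. finite \<F> \<and> \<F> \<subseteq> \<C>}"
  have "countable \<B>"
    unfolding \<B>_def using \<C>(1) by (intro countable_image countable_Collect_finite_subset)
  have open_\<B>: "openin X B" if "B \<in> \<B>" for B
    using that \<C>(2) by (auto simp: \<B>_def)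
  have base: "\<exists>B\<in>\<B>. x \<in> B \<and> B \<subseteq> U" if U: "openin X U" "x \<in> U" for U x
  proof -
    obtain B where B: "B \<in> \<C>" "x \<in> B" "B \<subseteq> U"
      using \<C>(3) U by blast
    then have "\<Union>{B} \<in> \<B>"
      unfolding \<B>_def by (intro imageI) auto
    then show ?thesis
      using B by auto
  qed
  have Union: "\<Union>\<F> \<in> \<B>" if "finite \<F>" "\<F> \<subseteq> \<B>" for \<F>
    using that
  proof (induction \<F> rule: finite_induct)
    case empty
    show ?case
      unfolding \<B>_def by (intro image_eqI[of _ _ "{}"]) auto
  next
    case (insert B \<F>)
    then obtain \<G> \<H> where "finite \<G>" "\<G> \<subseteq> \<C>" "B = \<Union>\<G>" "finite \<H>" "\<H> \<subseteq> \<C>" "\<Union>\<F> = \<Union>\<H>"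
      unfolding \<B>_def by auto
    then show ?case
      unfolding \<B>_def by (intro image_eqI[of _ _ "\<G> \<union> \<H>"]) auto
  qed
  \<comment> \<open>No \<open>f\<close> occurs in \<open>E\<close>, which is what keeps the family
    countable. The two base sets may overlap; then \<open>E\<close> is empty.\<close>
  define E where "E B = {g \<in> ?C. (\<forall>x\<in>fst B. g x = 0) \<and> (\<forall>x\<in>snd B. g x = 1)}" for B
  define \<N> where "\<N> = E ` (\<B> \<times> \<B>)"
  have "countable \<N>"
    unfolding \<N>_def using \<open>countable \<B>\<close> by auto
  have approx: "\<exists>V. (\<forall>n. V n \<subseteq> topspace X \<and> K \<subseteq> V n \<and> {g \<in> ?C. \<forall>x\<in>V n. g x = f x} \<in> \<N>) \<and>
      (\<forall>U. openin X U \<longrightarrow> K \<subseteq> U \<longrightarrow> (\<forall>\<^sub>F n in sequentially. V n \<subseteq> U))"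
    if f: "f \<in> ?C" and K: "compactin X K" for f K
  proof -
    have KX: "K \<subseteq> topspace X"
      by (rule compactin_subset_topspace[OF K])
    define shrinks where "shrinks i V \<longleftrightarrow>
        (\<forall>n. V n \<in> \<B> \<and> {x \<in> K. f x = i} \<subseteq> V n \<and> V n \<subseteq> {x \<in> topspace X. f x = i}) \<and>
        (\<forall>U. openin X U \<longrightarrow> {x \<in> K. f x = i} \<subseteq> U \<longrightarrow> (\<forall>\<^sub>F n in sequentially. V n \<subseteq> U))"
      for i and V :: "nat \<Rightarrow> 'a set"
    have "\<exists>V. shrinks i V" for i
    proof -
      have sub: "{x \<in> K. f x = i} \<subseteq> {x \<in> topspace X. f x = i}"
        using KX by auto
      obtain V where "\<And>n. V n \<in> \<B>" "\<And>n. {x \<in> K. f x = i} \<subseteq> V n"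
          "\<And>n. V n \<subseteq> {x \<in> topspace X. f x = i}"
          "\<And>U. openin X U \<Longrightarrow> {x \<in> K. f x = i} \<subseteq> U \<Longrightarrow> \<forall>\<^sub>F n in sequentially. V n \<subseteq> U"
        using compactin_shrinking_base_sequence[OF \<open>countable \<B>\<close> open_\<B> base Union
          compactin_Int_cont_maps_two_point_vimage[OF f K]
          openin_cont_maps_two_point_vimage[OF f] sub] by blast
      then show ?thesis
        unfolding shrinks_def by blast
    qed
    then obtain V where "\<And>i. shrinks i (V i)"
      by metis
    then have V: "\<And>i n. V i n \<in> \<B>" "\<And>i n. {x \<in> K. f x = i} \<subseteq> V i n"
        "\<And>i n. V i n \<subseteq> {x \<in> topspace X. f x = i}"
        "\<And>i U. openin X U \<Longrightarrow> {x \<in> K. f x = i} \<subseteq> U \<Longrightarrow> \<forall>\<^sub>F n in sequentially. V i n \<subseteq> U"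
      unfolding shrinks_def by blast+
    \<comment> \<open>Each \<open>V i n\<close> was kept inside the fibre of \<open>f\<close> over
      \<open>i\<close>, so agreeing with \<open>f\<close> there means having the constant value
      \<open>i\<close>.\<close>
    have "{g \<in> ?C. \<forall>x\<in>V 0 n \<union> V 1 n. g x = f x} = E (V 0 n, V 1 n)" for n
      using V(3)[of 0 n] V(3)[of 1 n] unfolding E_def by auto
    then have "{g \<in> ?C. \<forall>x\<in>V 0 n \<union> V 1 n. g x = f x} \<in> \<N>" for n
      using V(1) unfolding \<N>_def by auto
    moreover have "V 0 n \<union> V 1 n \<subseteq> topspace X" for n
      using V(3) by blast
    moreover have "K \<subseteq> V 0 n \<union> V 1 n" for n
      using V(2)[of 0 n] V(2)[of 1 n] cont_maps_two_point_values[OF f] KX by blast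
    moreover have "\<forall>\<^sub>F n in sequentially. V 0 n \<union> V 1 n \<subseteq> U" if "openin X U" "K \<subseteq> U" for U
      using V(4)[OF that(1), of 0] V(4)[OF that(1), of 1] that(2) by (auto simp: eventually_conj_iff)
    ultimately show ?thesis
      by (intro exI[of _ "\<lambda>n. V 0 n \<union> V 1 n"]) simp
  qed
  have "Pytkeev_network_at ?Z \<N> f" if f: "f \<in> ?C" for f
    unfolding Pytkeev_network_at_def network_at_def
  proof (intro conjI allI impI; elim conjE)
    fix U assume U: "openin ?Z U" "f \<in> U"
    obtain K where K: "compactin X K" "{g \<in> ?C. \<forall>x\<in>K. g x = f x} \<subseteq> U"
      using openin_compact_open_topology_agree[OF U] .
    obtain V :: "nat \<Rightarrow> 'a set" where
      V: "\<And>n. K \<subseteq> V n" "\<And>n. {g \<in> ?C. \<forall>x\<in>V n. g x = f x} \<in> \<N>"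
      using approx[OF f K(1)] by blast
    have "f \<in> {g \<in> ?C. \<forall>x\<in>V 0. g x = f x}" "{g \<in> ?C. \<forall>x\<in>V 0. g x = f x} \<subseteq> U"
      using V(1)[of 0] K(2) f by auto
    then show "\<exists>N\<in>\<N>. f \<in> N \<and> N \<subseteq> U"
      by (intro bexI[OF _ V(2)[of 0]] conjI)
  next
    fix U A assume U: "openin ?Z U" "f \<in> U" and A: "A \<subseteq> topspace ?Z" "accumulates_at ?Z A f"
    obtain K where K: "compactin X K" "{g \<in> ?C. \<forall>x\<in>K. g x = f x} \<subseteq> U"
      using openin_compact_open_topology_agree[OF U] .
    obtain V where "\<forall>n. V n \<subseteq> topspace X \<and> K \<subseteq> V n \<and> {g \<in> ?C. \<forall>x\<in>V n. g x = f x} \<in> \<N>"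
      and shrink: "\<forall>U. openin X U \<longrightarrow> K \<subseteq> U \<longrightarrow> (\<forall>\<^sub>F n in sequentially. V n \<subseteq> U)"
      using approx[OF f K(1)] by (elim exE conjE) (rule that)
    then have V: "\<And>n. V n \<subseteq> topspace X" "\<And>n. K \<subseteq> V n"
        "\<And>n. {g \<in> ?C. \<forall>x\<in>V n. g x = f x} \<in> \<N>"
      by simp_all
    obtain n where "infinite {g \<in> A. \<forall>x\<in>V n. g x = f x}"
      using not_accumulates_at_compact_open_topology[OF f K(1) _ V(1) shrink[rule_format], of A] A by auto
    moreover have "{g \<in> ?C. \<forall>x\<in>V n. g x = f x} \<inter> A = {g \<in> A. \<forall>x\<in>V n. g x = f x}"
      using A by auto
    moreover have "{g \<in> ?C. \<forall>x\<in>V n. g x = f x} \<subseteq> U"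
      using K(2) V(2)[of n] by blast
    ultimately show "\<exists>N\<in>\<N>. N \<subseteq> U \<and> infinite (N \<inter> A)"
      by (intro bexI[OF _ V(3)[of n]]) simp
  qed
  then have "Pytkeev_network ?Z \<N>"
    by (auto simp: Pytkeev_network_def \<N>_def E_def)
  then show ?thesis
    using \<open>countable \<N>\<close> unfolding P0_space_def by blast
qed

theorem theorem1p7:
  fixes M :: "'a set" and d :: "'a \<Rightarrow> 'a \<Rightarrow> real" and X :: "'a topology"
  assumes "Metric_space M d"
    and "X = Metric_space.mtopology M d"
    and "zero_dimensional X"
  shows "(countable_tightness (compact_open_topology X two_point) \<longleftrightarrow>
            P0_space (compact_open_topology X two_point)) \<and>
         (P0_space (compact_open_topology X two_point) \<longleftrightarrow>
            countable_tightness (pointwise_topology X two_point)) \<and>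
         (countable_tightness (pointwise_topology X two_point) \<longleftrightarrow> separable_space X)"
proof -
  interpret Metric_space M d
    by fact
  let ?C = "cont_maps X two_point"
  have zd: "zero_dimensional mtopology" and X: "X = mtopology"
    using assms by auto
  have eval: "openin (pointwise_topology X two_point) {g \<in> ?C. g x = 0}" if "x \<in> M" for x
    using that openin_pointwise_topology_eval[of x X two_point "{0}"] X
    by (simp add: two_point_def)
  have agree: "\<exists>K. compactin X K \<and> {g \<in> ?C. \<forall>x\<in>K. g x = f x} \<subseteq> U"
    if "openin (compact_open_topology X two_point) U" "f \<in> U" for U f
    using openin_compact_open_topology_agree[OF that] by blast
  \<comment> \<open>The implications form two cycles: either tightness gives separability, this
    gives the countable Pytkeev network, and that gives both tightness properties.\<close>
  have "separable_space X" if "countable_tightness (compact_open_topology X two_point)"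
    using countable_tightness_imp_separable[OF zd that] agree
      openin_compact_open_topology_if_pointwise[OF eval] by (simp add: X)
  moreover have "separable_space X" if "countable_tightness (pointwise_topology X two_point)"
    using countable_tightness_imp_separable[OF zd that] eval
      agree[OF openin_compact_open_topology_if_pointwise] by (simp add: X)
  moreover have "P0_space (compact_open_topology X two_point)" if "separable_space X"
    using that X
    by (simp add: separable_imp_second_countable_mtopology P0_space_compact_open_topology_two_point)
  moreover have "countable_tightness (compact_open_topology X two_point)"
      "countable_tightness (pointwise_topology X two_point)"
    if "P0_space (compact_open_topology X two_point)"
    by (rule P0_space_imp_countable_tightness_coarser[OF that];
        simp add: openin_compact_open_topology_if_pointwise)+
  ultimately show ?thesis
    by blast
qed

end
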